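(* Let $\mathcal{D}\subset\mathbb{R}^{n_d}$ be the disjoint union of a safe region $\mathcal{S}^*$ and an unsafe region $\mathcal{U}^*$, and let $X^u\subset\mathcal{U}^*$ be a finite set of unsafe sample points. Let $\epsilon>0$, $\sigma>0$, and let $\mathcal{C}=\{c_1,\dots,c_{n_c}\}$ be an $\epsilon$-cover of $X^u$ whose $\epsilon$-balls also cover the unsafe region, i.e., for every $x\in\mathcal{U}^*$ there is $c_i\in\mathcal{C}$ with $\|x-c_i\|\le\epsilon$. Suppose that the Gaussian kernel mapping $\vec k:\mathbb{R}^{n_d}\to\mathbb{R}^{n_c}$ with centers $\mathcal{C}$ and bandwidth $\sigma$ is a kernel embedding. Then there exists a vector $\vec b\in\mathbb{R}^{n_c}$ such that the set $$\mathcal{S}=\{x\in\mathcal{D} : \langle \vec b,\vec k(x)\rangle<1\}$$ satisfies $\mathcal{S}\subset\mathcal{S}^*\subset\mathcal{D}$ and $X^u\subset\bar{\mathcal{S}}$, where $\bar{\mathcal{S}}=\mathcal{D}\setminus\mathcal{S}$ is the complement of $\mathcal{S}$ in $\mathcal{D}$.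
   Context: $\|\cdot\|$ is the Euclidean norm and $\langle\cdot,\cdot\rangle$ the standard inner product. Gaussian kernel mapping: for centers $c_1,\dots,c_{n_c}\in\mathbb{R}^{n_d}$ and bandwidth $\sigma>0$, $\vec k(x)=[k(x,c_1),\dots,k(x,c_{n_c})]^T$ with $k(x,c)=\exp(-\|x-c\|^2/\sigma^2)$. Kernel embedding: the kernel mapping $\vec k:\mathbb{R}^{n_d}\to\mathbb{R}^{n_c}$ generated by a finite center set $\mathcal{C}\subset\mathcal{D}$ is a kernel embedding if it is one-to-one and the kernel function $k:\mathbb{R}^{n_d}\times\mathbb{R}^{n_d}\to\mathbb{R}$ is differentiable. $\epsilon$-cover: for $A\subset\mathbb{R}^{n_d}$ and $\epsilon>0$, a set $\mathcal{C}\subset A$ is an $\epsilon$-cover of $A$ if for every $x\in A$ there is $c_i\in\mathcal{C}$ with $\|x-c_i\|\le\epsilon$. *)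

theory Defs
  imports "HOL-Analysis.Analysis"
begin

definition eps_cover :: "real \<Rightarrow> (real ^ 'd) set \<Rightarrow> (real ^ 'd) set \<Rightarrow> bool" where
  "eps_cover \<epsilon> A C \<longleftrightarrow> C \<subseteq> A \<and> (\<forall>x\<in>A. \<exists>c\<in>C. norm (x - c) \<le> \<epsilon>)"

definition gaussian_kernel :: "real \<Rightarrow> real ^ 'd \<Rightarrow> real ^ 'd \<Rightarrow> real" where
  "gaussian_kernel \<sigma> x y = exp (- ((norm (x - y))\<^sup>2 / \<sigma>\<^sup>2))"

text \<open>
  A finite list of centers is a family \<open>c\<close> indexed by a finite type \<open>'c\<close>, whose cardinality
  is the number of centers; the center set is \<open>range c\<close>.
\<close>

definition kernel_map ::
    "(real ^ 'd \<Rightarrow> real ^ 'd \<Rightarrow> real) \<Rightarrow> ('c \<Rightarrow> real ^ 'd) \<Rightarrow> real ^ 'd \<Rightarrow> real ^ 'c" where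
  "kernel_map k c x = (\<chi> i. k x (c i))"

text \<open>
  Injectivity is required on the whole space, not only on the domain \<open>D\<close>, and the kernel is
  differentiable jointly in its two arguments.
\<close>

definition kernel_embedding ::
    "(real ^ 'd) set \<Rightarrow> (real ^ 'd \<Rightarrow> real ^ 'd \<Rightarrow> real) \<Rightarrow> ('c::finite \<Rightarrow> real ^ 'd) \<Rightarrow> bool" where
  "kernel_embedding D k c \<longleftrightarrow>
     range c \<subseteq> D \<and> inj (kernel_map k c) \<and> (\<lambda>(x, y). k x y) differentiable_on UNIV"

end

theory Submission
  imports Defs
begin

text \<open>
  Give every center the weight \<open>exp (\<epsilon>\<^sup>2 / \<sigma>\<^sup>2)\<close>, the reciprocal of the kernel at distance \<open>\<epsilon>\<close>:
  a point within \<open>\<epsilon>\<close> of some center then gets a contribution of at least 1 from that center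
  alone, and the other contributions are positive.
\<close>

lemma gaussian_kernel_ge:
  assumes "norm (x - y) \<le> \<epsilon>"
  shows "exp (- (\<epsilon>\<^sup>2 / \<sigma>\<^sup>2)) \<le> gaussian_kernel \<sigma> x y"
  using power_mono[OF assms norm_ge_zero, of 2]
  by (simp add: gaussian_kernel_def divide_right_mono)

text \<open>Read contrapositively, a value below 1 certifies that \<open>x\<close> is farther than
  \<epsilon> from every center, so this weight vector separates covered points from the sublevel
  set.\<close>

lemma inner_kernel_map_gaussian_ge_1:
  fixes c :: "'c::finite \<Rightarrow> real ^ 'd"
  assumes "norm (x - c i) \<le> \<epsilon>"
  shows "1 \<le> (\<chi> j. exp (\<epsilon>\<^sup>2 / \<sigma>\<^sup>2)) \<bullet> kernel_map (gaussian_kernel \<sigma>) c x"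
proof -
  have "1 = exp (\<epsilon>\<^sup>2 / \<sigma>\<^sup>2) * exp (- (\<epsilon>\<^sup>2 / \<sigma>\<^sup>2))"
    by (simp flip: exp_add)
  also have "\<dots> \<le> exp (\<epsilon>\<^sup>2 / \<sigma>\<^sup>2) * gaussian_kernel \<sigma> x (c i)"
    using gaussian_kernel_ge[OF assms] by simp
  also have "\<dots> \<le> (\<Sum>j\<in>UNIV. exp (\<epsilon>\<^sup>2 / \<sigma>\<^sup>2) * gaussian_kernel \<sigma> x (c j))"
    by (rule member_le_sum) (auto simp: gaussian_kernel_def)
  finally show ?thesis
    by (simp add: inner_vec_def kernel_map_def)
qed

theorem theorem2:
  fixes D S_star U_star X_u :: "(real ^ 'd) set"
    and \<epsilon> \<sigma> :: real
    and c :: "'c::finite \<Rightarrow> real ^ 'd"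
  assumes "D = S_star \<union> U_star"
    and "S_star \<inter> U_star = {}"
    and "finite X_u"
    and "X_u \<subseteq> U_star"
    and "\<epsilon> > 0"
    and "\<sigma> > 0"
    and "eps_cover \<epsilon> X_u (range c)"
    and "\<forall>x\<in>U_star. \<exists>i. norm (x - c i) \<le> \<epsilon>"
    and "kernel_embedding D (gaussian_kernel \<sigma>) c"
  shows "\<exists>b :: real ^ 'c.
           let S = {x \<in> D. b \<bullet> kernel_map (gaussian_kernel \<sigma>) c x < 1}
           in S \<subseteq> S_star \<and> S_star \<subseteq> D \<and> X_u \<subseteq> D - S"
proof -
  define b :: "real ^ 'c" where "b = (\<chi> j. exp (\<epsilon>\<^sup>2 / \<sigma>\<^sup>2))"
  \<comment> \<open>The covering hypothesis is needed on all of \<open>U_star\<close>, not just on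
    the samples: this fact yields both nontrivial inclusions.\<close>
  have unsafe: "\<not> b \<bullet> kernel_map (gaussian_kernel \<sigma>) c x < 1" if x: "x \<in> U_star" for x
  proof -
    obtain i where "norm (x - c i) \<le> \<epsilon>"
      using bspec[OF assms(8) x] ..
    then show ?thesis
      unfolding b_def not_less by (rule inner_kernel_map_gaussian_ge_1)
  qed
  show ?thesis
    unfolding Let_def
  proof (intro exI[of _ b] conjI)
    \<comment> \<open>A point of \<open>D\<close> outside \<open>S_star\<close> would lie in
      \<open>U_star\<close>, contradicting \<open>unsafe\<close>.\<close>
    show "{x \<in> D. b \<bullet> kernel_map (gaussian_kernel \<sigma>) c x < 1} \<subseteq> S_star"
      using assms(1) unsafe by blast
    show "S_star \<subseteq> D"
      using assms(1) by blast
    \<comment> \<open>The samples inherit \<open>unsafe\<close> from \<open>U_star\<close>, which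
      also places them in \<open>D\<close>.\<close>
    show "X_u \<subseteq> D - {x \<in> D. b \<bullet> kernel_map (gaussian_kernel \<sigma>) c x < 1}"
      using assms(1,4) unsafe by blast
  qed
qed

end
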